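(* There exists a one-sided error $\alpha$-erasure-resilient $\varepsilon$-tester for convexity of real-valued functions on the line $[n]$ that works for all $\alpha,\varepsilon\in(0,1)$, with query complexity $O\!\left(\frac{\log n}{\varepsilon(1-\alpha)}\right)$.
   Context: Erasure-resilient testing: a function $f:[n]\to\mathbb{R}\cup\{\perp\}$ is $\alpha$-erased if it equals $\perp$ (erased) on at most an $\alpha$ fraction of $[n]$; $\mathcal{N}$ is the set of nonerased points; a restoration is any $f':[n]\to\mathbb{R}$ agreeing with $f$ on $\mathcal{N}$. An $\alpha$-erasure-resilient $\varepsilon$-tester for a property $\mathcal{P}$, given $\alpha,\varepsilon$ and query access to an $\alpha$-erased $f$ (queries return $f(x)$ or $\perp$; $\mathcal{N}$ is unknown in advance), must with probability at least $2/3$ accept if some restoration satisfies $\mathcal{P}$ and reject if every restoration must be changed on at least an $\varepsilon$ fraction of $\mathcal{N}$ to satisfy $\mathcal{P}$; one-sided error means acceptance with probability 1 in the first case; query complexity is the worst case number of queries. A function $f$ on a domain $\mathcal{D}\subseteq[n]$ is convex if $\frac{f(y)-f(x)}{y-x}\le\frac{f(z)-f(y)}{z-y}$ for all $x<y<z$ in $\mathcal{D}$. *)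

theory Defs
  imports "HOL-Probability.Probability"
begin

text \<open>
  Functions on the line \<open>[n] = {1..n}\<close> are total functions on \<open>nat\<close> of which only the values
  on \<open>{1..n}\<close> matter. The erased value is \<open>None\<close>.
\<close>

definition nonerased :: "nat \<Rightarrow> (nat \<Rightarrow> real option) \<Rightarrow> nat set" where
  "nonerased n f = {x \<in> {1..n}. f x \<noteq> None}"

definition erased_fun :: "nat \<Rightarrow> real \<Rightarrow> (nat \<Rightarrow> real option) \<Rightarrow> bool" where
  "erased_fun n \<alpha> f \<longleftrightarrow> real (card {x \<in> {1..n}. f x = None}) \<le> \<alpha> * real n"

definition restoration :: "nat \<Rightarrow> (nat \<Rightarrow> real option) \<Rightarrow> (nat \<Rightarrow> real) \<Rightarrow> bool" where
  "restoration n f f' \<longleftrightarrow> (\<forall>x \<in> nonerased n f. f x = Some (f' x))"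

definition convex_fun_on :: "nat set \<Rightarrow> (nat \<Rightarrow> real) \<Rightarrow> bool" where
  "convex_fun_on D f \<longleftrightarrow>
     (\<forall>x\<in>D. \<forall>y\<in>D. \<forall>z\<in>D. x < y \<longrightarrow> y < z \<longrightarrow>
        (f y - f x) / (real y - real x) \<le> (f z - f y) / (real z - real y))"

text \<open>
  Every restoration has to be changed on at least an \<open>\<epsilon>\<close> fraction of the nonerased points to
  satisfy \<open>P\<close>. Counting also the changes at erased points would give the same notion, since
  the restoration may be chosen to agree with \<open>g\<close> there.
\<close>

definition erased_far :: "nat \<Rightarrow> real \<Rightarrow> ((nat \<Rightarrow> real) \<Rightarrow> bool) \<Rightarrow> (nat \<Rightarrow> real option) \<Rightarrow> bool" where
  "erased_far n \<epsilon> P f \<longleftrightarrow>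
     (\<forall>f' g. restoration n f f' \<longrightarrow> P g \<longrightarrow>
        real (card {x \<in> nonerased n f. g x \<noteq> f' x}) \<ge> \<epsilon> * real (card (nonerased n f)))"

text \<open>
  Adaptive randomized query algorithms: halt with a verdict (\<open>True\<close> means accept), query a point
  and continue depending on the answer, or continue with a randomly drawn algorithm.
\<close>

datatype query_alg =
    Halt bool
  | Query nat "real option \<Rightarrow> query_alg"
  | Toss "query_alg pmf"

text \<open>The joint distribution of the verdict and the list of points queried on input \<open>f\<close>.\<close>

primrec run :: "(nat \<Rightarrow> real option) \<Rightarrow> query_alg \<Rightarrow> (bool \<times> nat list) pmf" where
  "run f (Halt b) = return_pmf (b, [])"
| "run f (Query x k) = map_pmf (\<lambda>(b, xs). (b, x # xs)) (run f (k (f x)))"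
| "run f (Toss p) = join_pmf (map_pmf (run f) p)"

definition accept_prob :: "(nat \<Rightarrow> real option) \<Rightarrow> query_alg \<Rightarrow> real" where
  "accept_prob f A = measure_pmf.prob (run f A) {(b, xs). b}"

definition reject_prob :: "(nat \<Rightarrow> real option) \<Rightarrow> query_alg \<Rightarrow> real" where
  "reject_prob f A = measure_pmf.prob (run f A) {(b, xs). \<not> b}"

definition erasure_resilient_tester ::
    "nat \<Rightarrow> real \<Rightarrow> real \<Rightarrow> ((nat \<Rightarrow> real) \<Rightarrow> bool) \<Rightarrow> query_alg \<Rightarrow> bool" where
  "erasure_resilient_tester n \<alpha> \<epsilon> P A \<longleftrightarrow>
     (\<forall>f. erased_fun n \<alpha> f \<longrightarrow>
        (\<forall>(b, xs) \<in> set_pmf (run f A). set xs \<subseteq> {1..n}) \<and>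
        ((\<exists>f'. restoration n f f' \<and> P f') \<longrightarrow> accept_prob f A \<ge> 2/3) \<and>
        (erased_far n \<epsilon> P f \<longrightarrow> reject_prob f A \<ge> 2/3))"

definition one_sided_error ::
    "nat \<Rightarrow> real \<Rightarrow> ((nat \<Rightarrow> real) \<Rightarrow> bool) \<Rightarrow> query_alg \<Rightarrow> bool" where
  "one_sided_error n \<alpha> P A \<longleftrightarrow>
     (\<forall>f. erased_fun n \<alpha> f \<longrightarrow> (\<exists>f'. restoration n f f' \<and> P f') \<longrightarrow> accept_prob f A = 1)"

text \<open>Worst case over the \<open>\<alpha>\<close>-erased inputs and over the coin tosses; repeated queries count.\<close>

definition query_complexity :: "nat \<Rightarrow> real \<Rightarrow> query_alg \<Rightarrow> enat" where
  "query_complexity n \<alpha> A =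
     (SUP f \<in> {f. erased_fun n \<alpha> f}. SUP (b, xs) \<in> set_pmf (run f A). enat (length xs))"

end

theory Submission
  imports Defs
begin

text \<open>
  One round picks a uniform point \<open>s\<close> of \<open>{1..n}\<close> and a uniform permutation of \<open>{1..n}\<close>. If \<open>s\<close> is
  not erased, the permutation serves as the priority order of a random binary search for \<open>s\<close>: a
  point is queried unless a nonerased point already found separates it from \<open>s\<close>. From every
  nonerased point that is found, the round then walks right to the next nonerased point, and it
  rejects if the values seen are not convex.

  A point \<open>w\<close> is found only if it has the highest priority among the nonerased points between \<open>w\<close>
  and \<open>s\<close>, so summing over \<open>s\<close> bounds the expected cost of a round by a harmonic sum, whatever the
  erasure pattern is. For a fixed permutation, the values at the points \<open>s\<close> that are not rejected
  form a convex function, which extends to \<open>{1..n}\<close>; so an \<open>\<epsilon>\<close>-far input has at least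
  \<open>\<epsilon> (1 - \<alpha>) n\<close> rejected points. The tester repeats the round \<open>2 / (\<epsilon> (1 - \<alpha>))\<close> times and
  accepts early when a query budget of a constant times the expected number of queries is exceeded.
\<close>

section \<open>Convex functions on finite sets\<close>

lemma convex_fun_on_subset: "convex_fun_on D f \<Longrightarrow> E \<subseteq> D \<Longrightarrow> convex_fun_on E f"
  unfolding convex_fun_on_def by blast

lemma convex_fun_on_cong:
  "(\<And>x. x \<in> D \<Longrightarrow> f x = g x) \<Longrightarrow> convex_fun_on D f \<longleftrightarrow> convex_fun_on D g"
  unfolding convex_fun_on_def by simp

text \<open>The slope over \<open>[x, z]\<close> is a weighted mean of the slopes over
  \<open>[x, y]\<close> and \<open>[y, z]\<close>, so it lies between them.\<close>

lemma slope_mono: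
  fixes x y z :: nat
  assumes "x < y" "y < z"
    "(f y - f x) / (real y - real x) \<le> (f z - f y) / (real z - real y)"
  shows "(f y - f x) / (real y - real x) \<le> (f z - f x) / (real z - real x)"
    and "(f z - f x) / (real z - real x) \<le> (f z - f y) / (real z - real y)"
proof -
  have p: "real y - real x > 0" "real z - real y > 0" "real z - real x > 0" using assms by auto
  have h: "(f y - f x) * (real z - real y) \<le> (f z - f y) * (real y - real x)"
    using assms(3) p by (simp add: field_simps)
  show "(f y - f x) / (real y - real x) \<le> (f z - f x) / (real z - real x)"
       "(f z - f x) / (real z - real x) \<le> (f z - f y) / (real z - real y)"
    using p h by (simp_all add: divide_simps) (simp_all add: algebra_simps)
qed

text \<open>The two sides overlap in the neighbours \<open>a\<close> and \<open>b\<close>, and the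
  slope of this shared chord separates the slopes on the left from those on the right. An overlap in
  one point would leave these uncompared.\<close>

lemma convex_fun_on_glue:
  assumes ab: "a < b" "a \<in> D" "b \<in> D"
    and gap: "\<And>x. x \<in> D \<Longrightarrow> x \<le> a \<or> b \<le> x"
    and left: "convex_fun_on (D \<inter> {..b}) f"
    and right: "convex_fun_on (D \<inter> {a..}) f"
  shows "convex_fun_on D f"
  unfolding convex_fun_on_def
proof (intro ballI impI)
  fix x y z
  assume D: "x \<in> D" "y \<in> D" "z \<in> D" and lt: "x < y" "y < z"
  let ?s = "\<lambda>u v. (f v - f u) / (real v - real u)"
  have L: "?s u v \<le> ?s v w" if "u \<in> D" "v \<in> D" "w \<in> D" "u < v" "v < w" "w \<le> b" for u v w
    using left that unfolding convex_fun_on_def by auto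
  have R: "?s u v \<le> ?s v w" if "u \<in> D" "v \<in> D" "w \<in> D" "u < v" "v < w" "a \<le> u" for u v w
    using right that unfolding convex_fun_on_def by auto
  have Lb: "?s u b \<le> ?s a b" "?s u a \<le> ?s a b" if "u \<in> D" "u < a" for u
    using slope_mono(2)[of u a b f] L[of u a b] that ab by auto
  have Rb: "?s a b \<le> ?s a v" "?s a b \<le> ?s b v" if "v \<in> D" "b < v" for v
    using slope_mono(1)[of a b v f] R[of a b v] that ab by auto
  \<comment> \<open>A triple inside neither side has \<open>x < a\<close> and \<open>b < z\<close>;
    as \<open>D\<close> has nothing strictly between \<open>a\<close> and \<open>b\<close>, its
    middle point is at most \<open>a\<close> or at least \<open>b\<close>.\<close>
  consider "z \<le> b" | "a \<le> x" | "x < a" "y \<le> a" "b < z" | "x < a" "b \<le> y" "b < z"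
    using gap[OF D(1)] gap[OF D(2)] gap[OF D(3)] by linarith
  then show "?s x y \<le> ?s y z"
  proof cases
    case 1
    then show ?thesis using L D lt by blast
  next
    case 2
    then show ?thesis using R D lt by blast
  next
    case 3
    have "?s y b \<le> ?s a b"
      using Lb(1)[of y] D 3 by (cases "y = a") auto
    then have "?s y b \<le> ?s b z"
      using Rb(2)[of z] D 3 by linarith
    then have "?s y b \<le> ?s y z"
      using slope_mono(1)[of y b z f] 3 ab by simp
    moreover have "?s x y \<le> ?s y b"
      using L[of x y b] D lt 3 ab by simp
    ultimately show ?thesis by linarith
  next
    case 4
    have "?s a b \<le> ?s a y"
      using Rb(1)[of y] D 4 by (cases "y = b") auto
    then have "?s x a \<le> ?s a y"
      using Lb(2)[of x] D 4 by linarith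
    then have "?s x y \<le> ?s a y"
      using slope_mono(2)[of x a y f] 4 ab by simp
    moreover have "?s a y \<le> ?s y z"
      using R[of a y z] D lt 4 ab by simp
    ultimately show ?thesis by linarith
  qed
qed

text \<open>Convexity with \<open>d\<close> as middle point puts every slope on the left of
  \<open>d\<close> below every slope on the right, so some \<open>m\<close> fits between.\<close>

lemma subgradient:
  assumes "convex_fun_on D f" "finite D" "d \<in> D"
  shows "\<exists>m. \<forall>y\<in>D. f y \<ge> f d + m * (real y - real d)"
proof -
  let ?s = "\<lambda>u v. (f v - f u) / (real v - real u)"
  let ?L = "(\<lambda>x. ?s x d) ` {x \<in> D. x < d}" and ?R = "(\<lambda>z. ?s d z) ` {z \<in> D. d < z}"
  have fin: "finite ?L" "finite ?R" using assms by auto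
  have le: "l \<le> r" if "l \<in> ?L" "r \<in> ?R" for l r
    using that assms unfolding convex_fun_on_def by auto
  have "\<exists>m. (\<forall>l\<in>?L. l \<le> m) \<and> (\<forall>r\<in>?R. m \<le> r)"
  proof (cases "?L = {}")
    case True
    show ?thesis
    proof (cases "?R = {}")
      case False
      then show ?thesis using True fin by (intro exI[of _ "Min ?R"]) auto
    qed (use True in auto)
  next
    case False
    then have "Max ?L \<in> ?L" using fin by (intro Max_in)
    then show ?thesis using fin le by (intro exI[of _ "Max ?L"] conjI ballI Max_ge) auto
  qed
  then obtain m where m: "\<And>l. l \<in> ?L \<Longrightarrow> l \<le> m" "\<And>r. r \<in> ?R \<Longrightarrow> m \<le> r" by blast
  have "f y \<ge> f d + m * (real y - real d)" if "y \<in> D" for y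
  proof -
    consider "y < d" | "y = d" | "d < y" by linarith
    then show ?thesis
    proof cases
      case 1
      then have "?s y d \<le> m" using that m(1) by blast
      then show ?thesis using 1 by (simp add: divide_simps) (simp add: algebra_simps)
    next
      case 3
      then have "m \<le> ?s d y" using that m(2) by blast
      then show ?thesis using 3 by (simp add: field_simps)
    qed simp
  qed
  then show ?thesis by blast
qed

text \<open>The extension is the maximum of the supporting lines at the points of \<open>D\<close>:
  a maximum of finitely many affine functions is convex, and it equals \<open>f\<close> on
  \<open>D\<close> because no supporting line exceeds \<open>f\<close> there.\<close>

lemma convex_extension:
  assumes "convex_fun_on D f" "finite D"
  shows "\<exists>g. convex_fun_on UNIV g \<and> (\<forall>x\<in>D. g x = f x)"
proof (cases "D = {}")
  case True
  then show ?thesis by (intro exI[of _ "\<lambda>_. 0"]) (simp add: convex_fun_on_def)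
next
  case False
  obtain m where m: "\<And>d y. d \<in> D \<Longrightarrow> y \<in> D \<Longrightarrow> f y \<ge> f d + m d * (real y - real d)"
    using subgradient[OF assms] by metis
  define l where "l d x = f d + m d * (real x - real d)" for d and x :: nat
  define g where "g x = Max ((\<lambda>d. l d x) ` D)" for x
  have g_ge: "l d x \<le> g x" if "d \<in> D" for d x
    unfolding g_def using that assms by (intro Max_ge) auto
  have g_in: "\<exists>d\<in>D. g x = l d x" for x
  proof -
    have "g x \<in> (\<lambda>d. l d x) ` D" unfolding g_def using False assms by (intro Max_in) auto
    then show ?thesis by blast
  qed
  \<comment> \<open>The line attaining the maximum at \<open>y\<close> is at most \<open>g\<close>
    at \<open>x\<close> and \<open>z\<close>, so its slope \<open>m d\<close> separates the two
    difference quotients.\<close>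
  have "(g y - g x) / (real y - real x) \<le> (g z - g y) / (real z - real y)"
    if xyz: "x < y" "y < z" for x y z
  proof -
    obtain d where d: "d \<in> D" "g y = l d y" using g_in by blast
    have "(g y - g x) / (real y - real x) \<le> m d"
      using g_ge[OF d(1), of x] d xyz unfolding l_def
      by (simp add: divide_simps) (simp add: algebra_simps)
    also have "m d \<le> (g z - g y) / (real z - real y)"
      using g_ge[OF d(1), of z] d xyz unfolding l_def
      by (simp add: divide_simps) (simp add: algebra_simps)
    finally show ?thesis .
  qed
  moreover have "g x = f x" if "x \<in> D" for x
    using g_ge[OF that, of x] g_in[of x] m[OF _ that] by (force simp: l_def intro: antisym)
  ultimately show ?thesis unfolding convex_fun_on_def by blast
qed

section \<open>Random search paths\<close>

text \<open>\<open>xs\<close> is read as a priority order, earliest entry highest. If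
  \<open>S\<close> contains no entry of \<open>xs\<close>, the value is the unspecified
  \<open>hd []\<close>.\<close>

definition first :: "'a list \<Rightarrow> 'a set \<Rightarrow> 'a" where
  "first xs S = hd (filter (\<lambda>y. y \<in> S) xs)"

lemma first_Cons: "first (x # xs) S = (if x \<in> S then x else first xs S)"
  by (simp add: first_def)

lemma first_in: "S \<inter> set xs \<noteq> {} \<Longrightarrow> first xs S \<in> S \<inter> set xs"
  by (induction xs) (auto simp: first_Cons)

lemma first_mono:
  "S' \<subseteq> S \<Longrightarrow> first xs S \<in> S' \<Longrightarrow> first xs S' = first xs S"
  by (induction xs) (auto simp: first_Cons first_def)

lemma first_append: "first (xs @ ys) S = (if S \<inter> set xs \<noteq> {} then first xs S else first ys S)"
  by (induction xs) (auto simp: first_Cons)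

lemma first_map: "inj g \<Longrightarrow> S \<inter> set xs \<noteq> {} \<Longrightarrow> first (map g xs) (g ` S) = g (first xs S)"
  by (induction xs) (auto simp: first_Cons inj_image_mem_iff)

text \<open>By symmetry: exchanging \<open>y\<close> and \<open>z\<close> throughout a permutation
  maps those in which \<open>y\<close> comes first in \<open>S\<close> injectively to those in which
  \<open>z\<close> does. So the classes are equally large, and they partition all
  permutations.\<close>

lemma card_first_eq:
  assumes "finite A" "S \<subseteq> A" "x \<in> S"
  shows "card {xs \<in> permutations_of_set A. first xs S = x} * card S = fact (card A)"
proof -
  let ?E = "\<lambda>y. {xs \<in> permutations_of_set A. first xs S = y}"
  have le: "card (?E y) \<le> card (?E z)" if "y \<in> S" "z \<in> S" for y z
  proof (rule card_inj_on_le)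
    let ?t = "Transposition.transpose y z"
    show "inj_on (map ?t) (?E y)"
      by (rule inj_on_subset[OF _ subset_UNIV]) (simp add: inj_map)
    show "finite (?E z)" by simp
    have "y \<in> A" "z \<in> A" using that assms by auto
    then have img: "?t ` S = S" "?t ` A = A" "?t y = z"
      using that by (simp_all add: transpose_image_eq)
    show "map ?t ` ?E y \<subseteq> ?E z"
    proof clarify
      fix xs assume xs: "xs \<in> permutations_of_set A" and y: "y = first xs S"
      have "first (map ?t xs) (?t ` S) = ?t (first xs S)"
        using xs that assms by (intro first_map) (auto dest: permutations_of_setD)
      moreover have "map ?t xs \<in> permutations_of_set A"
        using xs img unfolding permutations_of_set_def by (auto simp: distinct_map)
      ultimately show "map (Transposition.transpose (first xs S) z) xs \<in> permutations_of_set A \<and>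
          first (map (Transposition.transpose (first xs S) z) xs) S = z"
        using img y by simp
    qed
  qed
  have "fact (card A) = card (\<Union>y\<in>S. ?E y)"
  proof -
    have "first xs S \<in> S" if "xs \<in> permutations_of_set A" for xs
      using first_in[of S xs] permutations_of_setD(1)[OF that] assms by auto
    then have "(\<Union>y\<in>S. ?E y) = permutations_of_set A" by auto
    then show ?thesis using assms by simp
  qed
  also have "\<dots> = (\<Sum>y\<in>S. card (?E y))"
    using assms finite_subset by (intro card_UN_disjoint) auto
  also have "\<dots> = (\<Sum>y\<in>S. card (?E x))"
    using le assms by (intro sum.cong refl antisym) auto
  finally show ?thesis by (simp add: mult.commute)
qed

definition seg :: "nat \<Rightarrow> nat \<Rightarrow> nat set" where
  "seg x s = {min x s..max x s}"

lemma seg_ends [simp]: "x \<in> seg x s" "s \<in> seg x s"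
  by (auto simp: seg_def)

lemma seg_subset: "y \<in> seg x s \<Longrightarrow> seg y s \<subseteq> seg x s"
  by (auto simp: seg_def)

text \<open>For \<open>s\<close> in \<open>M\<close> and \<open>M \<subseteq> set xs\<close>, these
  are the ancestors of \<open>s\<close>, with \<open>s\<close> itself, in the treap with keys
  \<open>M\<close> and priority order \<open>xs\<close>.\<close>

definition search_path :: "nat list \<Rightarrow> nat set \<Rightarrow> nat \<Rightarrow> nat set" where
  "search_path xs M s = {x \<in> M. first xs (M \<inter> seg x s) = x}"

text \<open>\<open>b\<close> may lie outside \<open>N\<close>: from a start \<open>a\<close>, the
  relation reaches all points to its right up to and including the next point of
  \<open>N\<close>.\<close>

definition adjacent :: "nat set \<Rightarrow> nat \<Rightarrow> nat \<Rightarrow> bool" where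
  "adjacent N a b \<longleftrightarrow> a < b \<and> N \<inter> {a<..<b} = {}"

text \<open>\<open>N\<close> and \<open>M\<close> are separate because the induction below shrinks
  \<open>M\<close> to one side of a pivot while successors are still taken in all of
  \<open>N\<close>.\<close>

definition path_succ :: "nat list \<Rightarrow> nat set \<Rightarrow> nat set \<Rightarrow> nat \<Rightarrow> nat set" where
  "path_succ xs N M s = search_path xs M s \<union> {b \<in> N. \<exists>a \<in> search_path xs M s. adjacent N a b}"

lemma path_succ_mono:
  assumes "M' \<subseteq> M" "\<And>x. x \<in> M' \<Longrightarrow> M \<inter> seg x s = M' \<inter> seg x s"
  shows "path_succ xs N M' s \<subseteq> path_succ xs N M s"
proof -
  have "search_path xs M' s \<subseteq> search_path xs M s" using assms unfolding search_path_def by auto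
  then show ?thesis unfolding path_succ_def by blast
qed

text \<open>
  The search path of every point of \<open>M\<close> passes through the point \<open>v\<close> of \<open>M\<close> that comes first in
  the priority list, and through the successor of \<open>v\<close>. As nothing lies between these two,
  convexity to the left and to the right of \<open>v\<close> can be glued along them.
\<close>

lemma convex_fun_on_good_points:
  assumes "finite M" "M \<subseteq> N" "M \<subseteq> set xs" "G \<subseteq> M" "G \<noteq> {}" "T \<subseteq> N" "finite N"
    and "\<And>s. s \<in> G \<Longrightarrow> convex_fun_on (path_succ xs N M s \<union> T) f"
  shows "convex_fun_on (G \<union> T) f"
  using assms
proof (induction "card M" arbitrary: M G T rule: less_induct)
  case less
  define v where "v = first xs M"
  \<comment> \<open>\<open>?U\<close> is the pivot with its successor in \<open>N\<close>, if there
    is one. In the recursive calls it joins \<open>T\<close>, so that both sides share these points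
    for the gluing.\<close>
  let ?U = "insert v {b \<in> N. adjacent N v b}"
  have ne: "M \<inter> set xs \<noteq> {}" using less.prems(3-5) by blast
  have v: "v \<in> M" "v \<in> N" using first_in[OF ne] less.prems(2) unfolding v_def by auto
  have path_v: "v \<in> search_path xs M s" for s
    using v first_mono[of "M \<inter> seg v s" M xs] unfolding search_path_def v_def by simp
  have U: "?U \<subseteq> path_succ xs N M s" for s
    using path_v unfolding path_succ_def by blast
  have U_N: "?U \<subseteq> N" using v by auto
  have side: "convex_fun_on ((G \<inter> I) \<union> (T \<union> ?U)) f"
    if I: "v \<notin> I" "\<And>x s. x \<in> I \<Longrightarrow> s \<in> I \<Longrightarrow> seg x s \<subseteq> I" for I
  \<comment> \<open>Without a good point in \<open>I\<close>, only \<open>T\<close> and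
    \<open>?U\<close> remain, and any \<open>s\<close> in \<open>G\<close> certifies them; this is a
    use of \<open>G \<noteq> {}\<close>.\<close>
  proof (cases "G \<inter> I = {}")
    case True
    obtain s where "s \<in> G" using less.prems(5) by blast
    then have "convex_fun_on (path_succ xs N M s \<union> T) f" by (rule less.prems(8))
    then show ?thesis
      by (rule convex_fun_on_subset) (use True U[of s] in blast)
  next
    case False
    have "card (M \<inter> I) < card M"
      using v I less.prems(1) by (intro psubset_card_mono) auto
    then show ?thesis
    proof (rule less.hyps)
      fix s assume s: "s \<in> G \<inter> I"
      have "path_succ xs N (M \<inter> I) s \<subseteq> path_succ xs N M s"
      proof (rule path_succ_mono)
        fix x assume "x \<in> M \<inter> I"
        then show "M \<inter> seg x s = (M \<inter> I) \<inter> seg x s" using I(2)[of x s] s by blast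
      qed simp
      moreover have "convex_fun_on (path_succ xs N M s \<union> T) f"
        using s less.prems(8) by blast
      ultimately show "convex_fun_on (path_succ xs N (M \<inter> I) s \<union> (T \<union> ?U)) f"
        using U[of s] by (elim convex_fun_on_subset) blast
    qed (use False less.prems U_N in auto)
  qed
  have left: "convex_fun_on ((G \<inter> {..<v}) \<union> (T \<union> ?U)) f"
    by (rule side) (auto simp: seg_def)
  have right: "convex_fun_on ((G \<inter> {v<..}) \<union> (T \<union> ?U)) f"
    by (rule side) (auto simp: seg_def)
  have D_N: "G \<union> (T \<union> ?U) \<subseteq> N" using less.prems(2,4,6) U_N by blast
  have "convex_fun_on (G \<union> (T \<union> ?U)) f"
  \<comment> \<open>If \<open>v\<close> is the last point of \<open>N\<close>, the left side is
    everything; otherwise the next point \<open>b\<close> lies in \<open>?U\<close>, and the sides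
    overlap in \<open>v\<close> and \<open>b\<close>.\<close>
  proof (cases "N \<inter> {v<..} = {}")
    case True
    then have "G \<subseteq> insert v (G \<inter> {..<v})" using less.prems(2,4) by force
    then show ?thesis by (intro convex_fun_on_subset[OF left]) blast
  next
    case False
    define b where "b = Min (N \<inter> {v<..})"
    have b: "b \<in> N" "v < b" "\<And>x. x \<in> N \<Longrightarrow> v < x \<Longrightarrow> b \<le> x"
      using Min_in[of "N \<inter> {v<..}"] False less.prems(7) unfolding b_def by auto
    then have "adjacent N v b" unfolding adjacent_def by force
    then have bU: "b \<in> ?U" using b by blast
    show ?thesis
    proof (rule convex_fun_on_glue[OF b(2)])
      show "x \<le> v \<or> b \<le> x" if "x \<in> G \<union> (T \<union> ?U)" for x
        using that D_N b(3)[of x] by force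
      show "convex_fun_on ((G \<union> (T \<union> ?U)) \<inter> {..b}) f"
      proof (rule convex_fun_on_subset[OF left], rule subsetI)
        fix x assume x: "x \<in> (G \<union> (T \<union> ?U)) \<inter> {..b}"
        then have "x \<in> N" using D_N by blast
        then have "x < v \<or> x = v \<or> x = b" using b(3)[of x] x by force
        then show "x \<in> (G \<inter> {..<v}) \<union> (T \<union> ?U)" using x bU by blast
      qed
      show "convex_fun_on ((G \<union> (T \<union> ?U)) \<inter> {v..}) f"
        by (rule convex_fun_on_subset[OF right]) force
    qed (use bU in auto)
  qed
  then show ?case by (rule convex_fun_on_subset) blast
qed

section \<open>Composing and truncating query algorithms\<close>

primrec andthen :: "query_alg \<Rightarrow> query_alg \<Rightarrow> query_alg" where
  "andthen (Halt b) B = (if b then B else Halt False)"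
| "andthen (Query x k) B = Query x (\<lambda>a. andthen (k a) B)"
| "andthen (Toss p) B = Toss (map_pmf (\<lambda>A. andthen A B) p)"

text \<open>Running out of budget accepts, so truncation creates no rejections and one-sided error
  survives.\<close>

primrec truncate_alg :: "query_alg \<Rightarrow> nat \<Rightarrow> query_alg" where
  "truncate_alg (Halt b) q = Halt b"
| "truncate_alg (Query x k) q =
     (if q = 0 then Halt True else Query x (\<lambda>a. truncate_alg (k a) (q - 1)))"
| "truncate_alg (Toss p) q = Toss (map_pmf (\<lambda>A. truncate_alg A q) p)"

definition repeat_alg :: "nat \<Rightarrow> query_alg \<Rightarrow> query_alg" where
  "repeat_alg t A = ((andthen A) ^^ t) (Halt True)"

definition expected_queries :: "(nat \<Rightarrow> real option) \<Rightarrow> query_alg \<Rightarrow> ennreal" where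
  "expected_queries f A = (\<integral>\<^sup>+ r. of_nat (length (snd r)) \<partial>measure_pmf (run f A))"

lemma run_Toss: "run f (Toss p) = bind_pmf p (run f)"
  by (simp add: bind_eq_join_pmf)

lemma run_andthen:
  "run f (andthen A B) =
     bind_pmf (run f A) (\<lambda>(b, xs). if b then map_pmf (\<lambda>(c, ys). (c, xs @ ys)) (run f B)
                                    else return_pmf (False, xs))"
proof (induction A)
  case (Halt b)
  then show ?case by (simp add: bind_return_pmf case_prod_unfold)
next
  case (Query x k)
  have "run f (andthen (Query x k) B) =
      map_pmf (\<lambda>(b, xs). (b, x # xs)) (run f (andthen (k (f x)) B))"
    by simp
  also have "\<dots> = bind_pmf (run f (Query x k)) (\<lambda>(b, xs).
      if b then map_pmf (\<lambda>(c, ys). (c, xs @ ys)) (run f B) else return_pmf (False, xs))"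
    unfolding Query[OF rangeI] map_bind_pmf run.simps bind_map_pmf
    by (intro bind_pmf_cong refl) (simp add: case_prod_unfold map_pmf_comp)
  finally show ?case .
next
  case (Toss p)
  show ?case
    by (simp add: run_Toss bind_map_pmf bind_assoc_pmf del: run.simps)
      (intro bind_pmf_cong refl Toss)
qed

text \<open>A coupling: the truncated run is a function of the full run with the same coin
  tosses.\<close>

lemma run_truncate_alg:
  "run f (truncate_alg A q) =
     map_pmf (\<lambda>(b, xs). if length xs \<le> q then (b, xs) else (True, take q xs)) (run f A)"
proof (induction A arbitrary: q)
  case (Halt b)
  then show ?case by simp
next
  case (Query x k)
  show ?case
  proof (cases q)
    case 0
    have "map_pmf (\<lambda>(b, xs). if length xs \<le> q then (b, xs) else (True, take q xs))
            (run f (Query x k)) = map_pmf (\<lambda>_. (True, [])) (run f (k (f x)))"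
      by (simp add: 0 map_pmf_comp case_prod_unfold)
    then show ?thesis by (simp add: 0)
  next
    case (Suc r)
    have "run f (truncate_alg (Query x k) q) =
        map_pmf (\<lambda>(b, xs). (b, x # xs)) (run f (truncate_alg (k (f x)) r))"
      by (simp add: Suc)
    also have "\<dots> = map_pmf (\<lambda>(b, xs). if length xs \<le> q then (b, xs) else (True, take q xs))
        (run f (Query x k))"
      unfolding Query[OF rangeI] run.simps map_pmf_comp
      by (intro map_pmf_cong refl) (simp add: Suc case_prod_unfold)
    finally show ?thesis .
  qed
next
  case (Toss p)
  show ?case
    by (simp add: run_Toss bind_map_pmf map_bind_pmf del: run.simps)
      (intro bind_pmf_cong refl Toss)
qed

lemma reject_prob_eq: "reject_prob f A = 1 - accept_prob f A"
proof -
  have eq: "{(b, xs). \<not> b} = space (measure_pmf (run f A)) - {(b, xs). b}"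
    by (rule set_eqI) (simp add: case_prod_unfold)
  show ?thesis
    unfolding reject_prob_def accept_prob_def eq
    by (rule measure_pmf.prob_compl) simp
qed

lemma accept_prob_eq_pmf: "accept_prob f A = pmf (map_pmf fst (run f A)) True"
proof -
  have eq: "{(b, xs). b} = fst -` {True}"
    by (rule set_eqI) (simp add: case_prod_unfold)
  show ?thesis unfolding accept_prob_def eq by (rule pmf_map[symmetric])
qed

text \<open>\<open>B\<close> tosses fresh coins and runs only after acceptance, so the probabilities
  multiply.\<close>

lemma accept_prob_andthen: "accept_prob f (andthen A B) = accept_prob f A * accept_prob f B"
proof -
  let ?p = "map_pmf fst (run f A)"
  let ?h = "\<lambda>b. if b then map_pmf fst (run f B) else return_pmf False"
  have "map_pmf fst (run f (andthen A B)) = bind_pmf ?p ?h"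
    unfolding run_andthen map_bind_pmf bind_map_pmf
    by (intro bind_pmf_cong refl) (simp add: map_pmf_comp case_prod_unfold)
  then have "accept_prob f (andthen A B) = measure_pmf.expectation ?p (\<lambda>b. pmf (?h b) True)"
    unfolding accept_prob_eq_pmf by (metis pmf_bind)
  also have "\<dots> = (\<Sum>b\<in>UNIV. pmf (?h b) True * pmf ?p b)"
    by (rule integral_measure_pmf_real) (rule finite, rule UNIV_I)
  also have "\<dots> = accept_prob f A * accept_prob f B"
  proof -
    have "sum F UNIV = F True + F False" for F :: "bool \<Rightarrow> real"
      by (simp add: UNIV_bool)
    then show ?thesis
      unfolding accept_prob_eq_pmf by (simp only: if_True if_False pmf_return) (simp del: pmf_map)
  qed
  finally show ?thesis .
qed


lemma accept_prob_repeat_alg: "accept_prob f (repeat_alg t A) = accept_prob f A ^ t"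
proof -
  have "accept_prob f (Halt True) = 1"
    unfolding accept_prob_eq_pmf by simp
  then show ?thesis
    by (induction t) (simp_all add: repeat_alg_def accept_prob_andthen)
qed

lemma expected_queries_andthen:
  "expected_queries f (andthen A B) \<le> expected_queries f A + expected_queries f B"
proof -
  have "expected_queries f (andthen A B) \<le>
      (\<integral>\<^sup>+ r. (of_nat (length (snd r)) + expected_queries f B) \<partial>measure_pmf (run f A))"
    unfolding expected_queries_def run_andthen nn_integral_bind_pmf
    by (intro nn_integral_mono)
      (simp add: case_prod_unfold nn_integral_add measure_pmf.emeasure_space_1)
  also have "\<dots> = expected_queries f A + expected_queries f B"
    by (simp add: nn_integral_add expected_queries_def)
  finally show ?thesis .
qed

lemma expected_queries_repeat_alg:
  "expected_queries f (repeat_alg t A) \<le> of_nat t * expected_queries f A"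
proof (induction t)
  case 0
  then show ?case by (simp add: repeat_alg_def expected_queries_def)
next
  case (Suc t)
  have "expected_queries f (repeat_alg (Suc t) A)
      \<le> expected_queries f A + expected_queries f (repeat_alg t A)"
    by (simp add: repeat_alg_def expected_queries_andthen)
  also have "\<dots> \<le> expected_queries f A + of_nat t * expected_queries f A"
    by (intro add_mono Suc order_refl)
  finally show ?case by (simp add: algebra_simps)
qed

lemma queries_repeat_alg:
  assumes "\<And>b xs. (b, xs) \<in> set_pmf (run f A) \<Longrightarrow> set xs \<subseteq> X"
  assumes "(b, xs) \<in> set_pmf (run f (repeat_alg t A))"
  shows "set xs \<subseteq> X"
  using assms(2)
proof (induction t arbitrary: b xs)
  case 0
  then show ?case by (simp add: repeat_alg_def)
next
  case (Suc t)
  have "repeat_alg (Suc t) A = andthen A (repeat_alg t A)"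
    by (simp add: repeat_alg_def)
  with Suc.prems obtain c ys where c: "(c, ys) \<in> set_pmf (run f A)"
    "(b, xs) \<in> set_pmf (if c then map_pmf (\<lambda>(c, zs). (c, ys @ zs)) (run f (repeat_alg t A))
      else return_pmf (False, ys))"
    by (auto simp only: run_andthen set_bind_pmf split: prod.splits)
  show ?case
  proof (cases c)
    case True
    then obtain zs where "(b, zs) \<in> set_pmf (run f (repeat_alg t A))" "xs = ys @ zs"
      using c(2) by auto
    then show ?thesis using Suc.IH assms(1)[OF c(1)] by simp
  next
    case False
    then show ?thesis using c assms(1) by simp
  qed
qed

lemma set_pmf_truncate_alg:
  assumes "(b, xs) \<in> set_pmf (run f (truncate_alg A q))"
  shows "length xs \<le> q" "\<exists>c ys. (c, ys) \<in> set_pmf (run f A) \<and> set xs \<subseteq> set ys"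
proof -
  obtain c ys where "(c, ys) \<in> set_pmf (run f A)"
    "(b, xs) = (if length ys \<le> q then (c, ys) else (True, take q ys))"
    using assms by (auto simp: run_truncate_alg)
  then show "length xs \<le> q" "\<exists>c ys. (c, ys) \<in> set_pmf (run f A) \<and> set xs \<subseteq> set ys"
    by (auto split: if_splits dest: in_set_takeD)
qed

lemma reject_prob_truncate_alg_le: "reject_prob f (truncate_alg A q) \<le> reject_prob f A"
  unfolding reject_prob_def run_truncate_alg measure_map_pmf
  by (intro measure_pmf.finite_measure_mono) (auto split: if_splits)

text \<open>Markov's inequality: a rejecting run is lost only if it makes more than
  \<open>q\<close>, that is at least \<open>q + 1\<close>, queries, which has probability at most
  \<open>e / (q + 1)\<close>.\<close>

lemma reject_prob_truncate_alg_ge: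
  assumes "expected_queries f A \<le> ennreal e" "0 \<le> e"
  shows "reject_prob f (truncate_alg A q) \<ge> reject_prob f A - e / (real q + 1)"
proof -
  let ?P = "measure_pmf.prob (run f A)"
  let ?L = "{r. q < length (snd r)}"
  have "of_nat (q + 1) * emeasure (run f A) ?L
      = (\<integral>\<^sup>+ r. of_nat (q + 1) * indicator ?L r \<partial>measure_pmf (run f A))"
    by (rule nn_integral_cmult_indicator[symmetric]) simp
  also have "\<dots> \<le> expected_queries f A"
    unfolding expected_queries_def
    by (intro nn_integral_mono) (simp add: indicator_def del: of_nat_add of_nat_Suc)
  also note assms(1)
  finally have "ennreal (real (q + 1) * ?P ?L) \<le> ennreal e"
    by (simp only: ennreal_mult measure_pmf.emeasure_eq_measure of_nat_0_le_iff
        ennreal_of_nat_eq_real_of_nat measure_nonneg)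
  then have "real (q + 1) * ?P ?L \<le> e"
    using assms(2) by (simp only: ennreal_le_iff)
  then have "?P ?L \<le> e / (real q + 1)"
    by (simp add: field_simps)
  moreover have "reject_prob f A \<le> ?P (({(b, xs). \<not> b} - ?L) \<union> ?L)"
    unfolding reject_prob_def by (intro measure_pmf.finite_measure_mono) auto
  moreover have "?P (({(b, xs). \<not> b} - ?L) \<union> ?L) \<le> ?P ({(b, xs). \<not> b} - ?L) + ?P ?L"
    by (rule measure_subadditive) (simp_all add: measure_pmf.emeasure_eq_measure)
  moreover have "?P ({(b, xs). \<not> b} - ?L) \<le> reject_prob f (truncate_alg A q)"
    unfolding reject_prob_def run_truncate_alg measure_map_pmf
    by (intro measure_pmf.finite_measure_mono) (auto split: if_splits)
  ultimately show ?thesis by linarith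
qed

section \<open>One round of the tester\<close>

text \<open>The rule \<open>R\<close> sees only which points were found nonerased, since an erased
  answer stays outside \<open>dom h\<close>. So for a fixed rule the queries depend on the erasure
  pattern and not on the values; \<open>queried\<close> computes them.\<close>

primrec scan :: "(nat set \<Rightarrow> nat \<Rightarrow> bool) \<Rightarrow> nat list \<Rightarrow> (nat \<Rightarrow> real option) \<Rightarrow>
    ((nat \<Rightarrow> real option) \<Rightarrow> query_alg) \<Rightarrow> query_alg" where
  "scan R [] h k = k h"
| "scan R (x # xs) h k =
     (if R (dom h) x then Query x (\<lambda>a. scan R xs (h(x := a)) k) else scan R xs h k)"

primrec queried :: "nat set \<Rightarrow> (nat set \<Rightarrow> nat \<Rightarrow> bool) \<Rightarrow> nat list \<Rightarrow> nat set \<Rightarrow> nat list" where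
  "queried N R [] D = []"
| "queried N R (x # xs) D =
     (if R D x then x # queried N R xs (D \<union> (N \<inter> {x})) else queried N R xs D)"

lemma run_scan:
  "run f (scan R xs (f |` A) k) =
     map_pmf (\<lambda>(b, ys). (b, queried (dom f) R xs (dom f \<inter> A) @ ys))
       (run f (k (f |` (A \<union> set (queried (dom f) R xs (dom f \<inter> A))))))"
proof (induction xs arbitrary: A)
  case Nil
  show ?case by (simp add: case_prod_unfold)
next
  case (Cons x xs)
  have upd: "(f |` A)(x := f x) = f |` insert x A"
    by (auto simp: restrict_map_def fun_eq_iff)
  have D: "dom f \<inter> A \<union> dom f \<inter> {x} = dom f \<inter> insert x A" by blast
  show ?case
    by (simp add: upd Cons.IH D map_pmf_comp case_prod_unfold)
qed

lemma queried_append: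
  "queried N R (xs @ ys) D =
     queried N R xs D @ queried N R ys (D \<union> (N \<inter> set (queried N R xs D)))"
  by (induction xs arbitrary: D) (simp_all add: Int_insert_right Un_assoc)

lemma set_queried_subset: "set (queried N R xs D) \<subseteq> set xs"
  by (induction xs arbitrary: D) (auto split: if_splits)

lemma distinct_queried: "distinct xs \<Longrightarrow> distinct (queried N R xs D)"
  by (induction xs arbitrary: D) (auto dest: subsetD[OF set_queried_subset])

definition search :: "nat set \<Rightarrow> nat list \<Rightarrow> nat \<Rightarrow> nat list" where
  "search N xs s = queried N (\<lambda>D x. D \<inter> seg x s = {}) xs {}"

text \<open>One pass from left to right carries out the walks from all starts in \<open>V\<close>
  together; \<open>adjacent D v x\<close> says that the walk from \<open>v\<close> has met no
  nonerased point before \<open>x\<close>.\<close>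

definition walk :: "nat set \<Rightarrow> nat set \<Rightarrow> nat \<Rightarrow> nat list" where
  "walk N V n = queried N (\<lambda>D x. \<exists>v\<in>V. adjacent D v x) [1..<Suc n] {}"

text \<open>Blocking by found points amounts to blocking by all earlier nonerased points: the
  earliest nonerased point \<open>y\<close> of \<open>seg z s\<close> satisfies
  \<open>seg y s \<subseteq> seg z s\<close>, so nothing blocked it and it was queried. The
  \<open>insert x\<close> covers an erased \<open>x\<close>.\<close>

lemma set_search:
  assumes "distinct xs"
  shows "set (search N xs s) = {x \<in> set xs. first xs (insert x (N \<inter> seg x s)) = x}"
  using assms
proof (induction xs rule: rev_induct)
  case Nil
  show ?case by (simp add: search_def)
next
  case (snoc z xs)
  let ?S = "\<lambda>x. insert x (N \<inter> seg x s)"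
  have IH: "set (search N xs s) = {x \<in> set xs. first xs (?S x) = x}"
    using snoc by simp
  have old: "first (xs @ [z]) (?S x) = first xs (?S x)" if "x \<in> set xs" for x
    using that by (auto simp: first_append)
  have z: "z \<notin> set xs" using snoc.prems by simp
  have "first (xs @ [z]) (?S z) = z \<longleftrightarrow> set xs \<inter> N \<inter> seg z s = {}"
  proof (cases "?S z \<inter> set xs = {}")
    case True
    then show ?thesis using z by (auto simp: first_append first_Cons)
  next
    case False
    then have "first xs (?S z) \<noteq> z" using first_in[OF False] z by auto
    moreover have "set xs \<inter> N \<inter> seg z s \<noteq> {}" using False z by auto
    ultimately show ?thesis using False by (simp add: first_append)
  qed
  also have "\<dots> \<longleftrightarrow> N \<inter> set (search N xs s) \<inter> seg z s = {}"
  proof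
    assume e: "N \<inter> set (search N xs s) \<inter> seg z s = {}"
    show "set xs \<inter> N \<inter> seg z s = {}"
    proof (rule ccontr)
      assume "set xs \<inter> N \<inter> seg z s \<noteq> {}"
      then have ne: "(N \<inter> seg z s) \<inter> set xs \<noteq> {}" by blast
      define y where "y = first xs (N \<inter> seg z s)"
      have y: "y \<in> N" "y \<in> seg z s" "y \<in> set xs" using first_in[OF ne] unfolding y_def by auto
      have "first xs (?S y) = y"
        using first_mono[of "?S y" "N \<inter> seg z s" xs] y seg_subset[OF y(2)] unfolding y_def by auto
      then show False using e y IH by blast
    qed
  qed (use IH in blast)
  finally have new: "first (xs @ [z]) (?S z) = z \<longleftrightarrow> N \<inter> set (search N xs s) \<inter> seg z s = {}" .
  have "set (search N (xs @ [z]) s) =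
      set (search N xs s) \<union> (if N \<inter> set (search N xs s) \<inter> seg z s = {} then {z} else {})"
    by (simp add: search_def queried_append)
  also have "\<dots> = {x \<in> set (xs @ [z]). first (xs @ [z]) (?S x) = x}"
    using IH old new z by auto
  finally show ?case .
qed

text \<open>As for the search: if nonerased points lie between \<open>v\<close> and
  \<open>y\<close>, the first of them was queried and stops the walk from \<open>v\<close>.\<close>

lemma set_walk: "set (walk N V n) = {y \<in> {1..n}. \<exists>v\<in>V. adjacent N v y}"
proof (induction n)
  case 0
  show ?case by (simp add: walk_def)
next
  case (Suc n)
  let ?W = "set (walk N V n)"
  have "adjacent (N \<inter> ?W) v (Suc n) \<longleftrightarrow> adjacent N v (Suc n)" if "v \<in> V" for v
  proof
    assume a: "adjacent (N \<inter> ?W) v (Suc n)"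
    show "adjacent N v (Suc n)"
    proof (rule ccontr)
      assume "\<not> adjacent N v (Suc n)"
      then have ne: "N \<inter> {v<..<Suc n} \<noteq> {}" using a unfolding adjacent_def by blast
      define u where "u = Min (N \<inter> {v<..<Suc n})"
      have u: "u \<in> N" "v < u" "u < Suc n"
        using Min_in[of "N \<inter> {v<..<Suc n}"] ne unfolding u_def by auto
      have "u \<le> x" if "x \<in> N \<inter> {v<..<Suc n}" for x
        unfolding u_def using that by (intro Min_le) auto
      then have "adjacent N v u" using u unfolding adjacent_def by force
      then have "u \<in> ?W" using Suc \<open>v \<in> V\<close> u by auto
      then show False using a u unfolding adjacent_def by auto
    qed
  qed (auto simp: adjacent_def)
  moreover have "set (walk N V (Suc n)) =
      ?W \<union> (if \<exists>v\<in>V. adjacent (N \<inter> ?W) v (Suc n) then {Suc n} else {})"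
    by (simp add: walk_def queried_append)
  ultimately show ?case using Suc by (auto simp: le_Suc_eq)
qed

text \<open>Stopping at an erased \<open>s\<close> keeps the cost down: the harmonic bound below
  sums over nonerased \<open>s\<close> only.\<close>

definition test :: "nat \<Rightarrow> nat \<Rightarrow> nat list \<Rightarrow> query_alg" where
  "test n s xs = Query s (\<lambda>a. if a = None then Halt True else
     scan (\<lambda>D x. D \<inter> seg x s = {}) xs Map.empty (\<lambda>h.
       scan (\<lambda>D x. \<exists>v\<in>dom h. adjacent D v x) [1..<Suc n] Map.empty (\<lambda>h'.
         Halt (convex_fun_on (dom h \<union> dom h') (\<lambda>x. the ((h ++ h') x))))))"

definition seen :: "nat set \<Rightarrow> nat \<Rightarrow> nat \<Rightarrow> nat list \<Rightarrow> nat list" where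
  "seen N n s xs = search N xs s @ walk N (N \<inter> set (search N xs s)) n"

definition verdict :: "(nat \<Rightarrow> real option) \<Rightarrow> nat \<Rightarrow> nat \<Rightarrow> nat list \<Rightarrow> bool" where
  "verdict f n s xs \<longleftrightarrow>
     s \<notin> dom f \<or> convex_fun_on (dom f \<inter> set (seen (dom f) n s xs)) (\<lambda>x. the (f x))"

definition transcript :: "(nat \<Rightarrow> real option) \<Rightarrow> nat \<Rightarrow> nat \<Rightarrow> nat list \<Rightarrow> nat list" where
  "transcript f n s xs = s # (if s \<in> dom f then seen (dom f) n s xs else [])"

text \<open>For fixed \<open>s\<close> and \<open>xs\<close> no randomness remains, so probabilities
  and expectations become counts over pairs \<open>(s, xs)\<close>.\<close>

lemma run_test: "run f (test n s xs) = return_pmf (verdict f n s xs, transcript f n s xs)"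
proof (cases "s \<in> dom f")
  case False
  then show ?thesis by (simp add: test_def verdict_def transcript_def domIff)
next
  case True
  define P where "P = search (dom f) xs s"
  define Q where "Q = walk (dom f) (dom f \<inter> set P) n"
  \<comment> \<open>The empty map is written as a restriction of \<open>f\<close>, the form in which
    \<open>run_scan\<close> applies.\<close>
  have emp: "Map.empty = f |` {}" by (simp add: restrict_map_empty)
  have conv: "convex_fun_on (dom (f |` set P) \<union> dom (f |` set Q)) (\<lambda>x. the ((f |` set P ++ f |` set Q) x))
     = convex_fun_on (dom f \<inter> (set P \<union> set Q)) (\<lambda>x. the (f x))"
  proof -
    have "dom (f |` set P) \<union> dom (f |` set Q) = dom f \<inter> (set P \<union> set Q)" by auto
    then show ?thesis
      by (auto intro!: convex_fun_on_cong simp: map_add_def restrict_map_def split: option.split)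
  qed
  have "run f (scan (\<lambda>D x. D \<inter> seg x s = {}) xs Map.empty (\<lambda>h.
       scan (\<lambda>D x. \<exists>v\<in>dom h. adjacent D v x) [1..<Suc n] Map.empty (\<lambda>h'.
         Halt (convex_fun_on (dom h \<union> dom h') (\<lambda>x. the ((h ++ h') x))))))
     = return_pmf (convex_fun_on (dom f \<inter> (set P \<union> set Q)) (\<lambda>x. the (f x)), P @ Q)"
    unfolding emp run_scan conv[symmetric]
    by (simp add: P_def Q_def search_def walk_def del: upt_Suc)
  then show ?thesis
    using True unfolding test_def verdict_def transcript_def seen_def P_def Q_def by auto
qed

section \<open>Expected number of queries in a round\<close>

lemma sum_inverse_le_harm:
  assumes "finite A" "inj_on c A" "\<And>s. s \<in> A \<Longrightarrow> c s \<in> {1..n}"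
  shows "(\<Sum>s\<in>A. 1 / real (c s)) \<le> harm n"
proof -
  have "(\<Sum>s\<in>A. 1 / real (c s)) = (\<Sum>k\<in>c ` A. 1 / real k)"
    using assms(2) by (simp add: sum.reindex)
  also have "\<dots> \<le> (\<Sum>k\<in>{1..n}. 1 / real k)"
    using assms(3) by (intro sum_mono2) auto
  finally show ?thesis by (simp add: harm_def divide_inverse)
qed

text \<open>As \<open>s\<close> moves away from \<open>w\<close> on one side, the counts strictly
  increase, so they are distinct numbers in \<open>{1..n}\<close>; each of the two sides contributes
  at most \<open>harm n\<close>.\<close>

lemma sum_inverse_card_seg_le:
  assumes "N \<subseteq> {1..n}"
  shows "(\<Sum>s\<in>N. 1 / real (card (N \<inter> seg w s))) \<le> 2 * harm n"
proof -
  have fin: "finite N" using assms finite_subset by blast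
  have range: "card (N \<inter> seg w s) \<in> {1..n}" if "s \<in> N" for s
  proof -
    have "card (N \<inter> seg w s) \<le> card {1..n}" using assms by (intro card_mono) auto
    moreover have "card (N \<inter> seg w s) \<noteq> 0" using that fin by (auto simp: card_eq_0_iff)
    ultimately show ?thesis by simp
  qed
  have less: "card (N \<inter> seg w s) < card (N \<inter> seg w t)" if "t \<in> N" "seg w s \<subseteq> seg w t" "t \<notin> seg w s" for s t
    using that fin by (intro psubset_card_mono) auto
  have "inj_on (\<lambda>s. card (N \<inter> seg w s)) (N \<inter> {w..})"
  proof (rule linorder_inj_onI)
    fix s t assume "s < t" "s \<in> N \<inter> {w..}" "t \<in> N \<inter> {w..}"
    then show "card (N \<inter> seg w s) \<noteq> card (N \<inter> seg w t)"
      using less[of t s] by (auto simp: seg_def)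
  qed auto
  then have up: "(\<Sum>s\<in>N \<inter> {w..}. 1 / real (card (N \<inter> seg w s))) \<le> harm n"
    using fin range by (intro sum_inverse_le_harm) auto
  have "inj_on (\<lambda>s. card (N \<inter> seg w s)) (N - {w..})"
  proof (rule linorder_inj_onI)
    fix s t assume "s < t" "s \<in> N - {w..}" "t \<in> N - {w..}"
    then show "card (N \<inter> seg w s) \<noteq> card (N \<inter> seg w t)"
      using less[of s t] by (auto simp: seg_def)
  qed auto
  then have down: "(\<Sum>s\<in>N - {w..}. 1 / real (card (N \<inter> seg w s))) \<le> harm n"
    using fin range by (intro sum_inverse_le_harm) auto
  show ?thesis
    using up down sum.Int_Diff[OF fin, of "\<lambda>s. 1 / real (card (N \<inter> seg w s))" "{w..}"] by simp
qed

text \<open>For fixed \<open>s\<close>, a random permutation puts \<open>w\<close> first in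
  \<open>insert w (N \<inter> seg w s)\<close> with probability one over its size, and an erased
  \<open>w\<close> only enlarges this set. The factor \<open>fact n\<close> turns probabilities into
  counts.\<close>

lemma search_hits_le:
  assumes "w \<in> {1..n}"
  shows "(\<Sum>s\<in>N \<inter> {1..n}. \<Sum>xs\<in>permutations_of_set {1..n}.
       of_bool (w \<in> set (search N xs s)) :: real) \<le> 2 * harm n * fact n"
proof -
  let ?N = "N \<inter> {1..n}" and ?\<Pi> = "permutations_of_set {1..n}"
  have "(\<Sum>xs\<in>?\<Pi>. of_bool (w \<in> set (search N xs s))) \<le> fact n * (1 / real (card (?N \<inter> seg w s)))"
    if s: "s \<in> ?N" for s
  proof -
    have seg: "seg w s \<subseteq> {1..n}" using assms s by (auto simp: seg_def)
    then have N: "N \<inter> seg w s = ?N \<inter> seg w s" by (simp add: Int_assoc Int_absorb1)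
    let ?S = "insert w (N \<inter> seg w s)"
    have S: "?S \<subseteq> {1..n}" using seg assms by (intro insert_subsetI le_infI2) auto
    then have finS: "finite ?S" by (rule finite_subset) simp
    have "s \<in> ?N \<inter> seg w s" using s by simp
    then have pos: "0 < card (?N \<inter> seg w s)" by (subst card_gt_0_iff) blast
    have le: "card (?N \<inter> seg w s) \<le> card ?S"
      using finS unfolding N[symmetric] by (rule card_mono) blast
    have "(\<Sum>xs\<in>?\<Pi>. of_bool (w \<in> set (search N xs s)))
        = (\<Sum>xs\<in>?\<Pi>. of_bool (first xs ?S = w) :: real)"
    proof (intro sum.cong refl)
      fix xs assume "xs \<in> ?\<Pi>"
      note xs = permutations_of_setD[OF this]
      show "of_bool (w \<in> set (search N xs s)) = (of_bool (first xs ?S = w) :: real)"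
        unfolding set_search[OF xs(2)] using xs(1) assms by simp
    qed
    also have "\<dots> = real (card {xs \<in> ?\<Pi>. first xs ?S = w})"
      by (simp add: sum_of_bool_eq Int_def)
    also have "\<dots> = fact n / real (card ?S)"
    proof -
      have "real (card {xs \<in> ?\<Pi>. first xs ?S = w} * card ?S) = fact n"
        using S by (subst card_first_eq) auto
      then show ?thesis using finS by (simp add: field_simps)
    qed
    also have "\<dots> \<le> fact n * (1 / real (card (?N \<inter> seg w s)))"
      using pos le by (simp add: frac_le)
    finally show ?thesis .
  qed
  then have "(\<Sum>s\<in>?N. \<Sum>xs\<in>?\<Pi>. of_bool (w \<in> set (search N xs s)))
      \<le> (\<Sum>s\<in>?N. fact n * (1 / real (card (?N \<inter> seg w s))))"
    by (intro sum_mono)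
  also have "\<dots> \<le> fact n * (2 * harm n)"
    unfolding sum_distrib_left[symmetric] by (intro mult_left_mono sum_inverse_card_seg_le) auto
  finally show ?thesis by (simp add: mult_ac)
qed

text \<open>The default \<open>y\<close> keeps the value in \<open>{1..n}\<close>, where
  \<open>search_hits_le\<close> applies.\<close>

definition pred_in :: "nat set \<Rightarrow> nat \<Rightarrow> nat" where
  "pred_in N y = (if N \<inter> {1..<y} = {} then y else Max (N \<inter> {1..<y}))"

lemma pred_in_range: "y \<in> {1..n} \<Longrightarrow> pred_in N y \<in> {1..n}"
  using Max_in[of "N \<inter> {1..<y}"] by (auto simp: pred_in_def)

text \<open>A query of the walk is charged to the point where this walk started.\<close>

lemma length_seen_le:
  assumes "xs \<in> permutations_of_set {1..n}"
  shows "length (seen N n s xs) \<le>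
    (\<Sum>x\<in>{1..n}. of_bool (x \<in> set (search N xs s)) + of_bool (pred_in N x \<in> set (search N xs s)))"
proof -
  let ?P = "set (search N xs s)" and ?W = "walk N (N \<inter> set (search N xs s)) n"
  note xs = permutations_of_setD[OF assms]
  have P: "?P \<subseteq> {1..n}" unfolding search_def xs(1)[symmetric] by (rule set_queried_subset)
  have "distinct (search N xs s)" unfolding search_def using xs(2) by (rule distinct_queried)
  then have "length (search N xs s) = card ?P" by (simp add: distinct_card)
  also have "\<dots> = (\<Sum>x\<in>{1..n}. of_bool (x \<in> ?P))"
    using P by (simp add: sum_of_bool_eq Int_absorb1)
  finally have 1: "length (search N xs s) = (\<Sum>x\<in>{1..n}. of_bool (x \<in> ?P))" .
  \<comment> \<open>Nothing nonerased lies strictly between the start \<open>v\<close> and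
    \<open>y\<close>, so \<open>y\<close> determines \<open>v\<close> as its predecessor.\<close>
  have "set ?W \<subseteq> {1..n} \<inter> {y. pred_in N y \<in> ?P}"
  proof
    fix y assume "y \<in> set ?W"
    then obtain v where v: "y \<in> {1..n}" "v \<in> N" "v \<in> ?P" "adjacent N v y"
      by (auto simp: set_walk)
    from v(3) P have "1 \<le> v" by auto
    with v have in_N: "v \<in> N \<inter> {1..<y}" by (simp add: adjacent_def)
    moreover have "x \<le> v" if "x \<in> N \<inter> {1..<y}" for x
      using that v(4) by (force simp: adjacent_def)
    ultimately have "Max (N \<inter> {1..<y}) = v" by (intro Max_eqI) auto
    then show "y \<in> {1..n} \<inter> {y. pred_in N y \<in> ?P}" using v in_N by (auto simp: pred_in_def)
  qed
  then have "card (set ?W) \<le> card ({1..n} \<inter> {y. pred_in N y \<in> ?P})" by (intro card_mono) auto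
  moreover have "distinct ?W" unfolding walk_def by (intro distinct_queried) simp
  ultimately have 2: "length ?W \<le> (\<Sum>x\<in>{1..n}. of_bool (pred_in N x \<in> ?P))"
    by (simp add: distinct_card sum_of_bool_eq)
  show ?thesis using 1 2 by (simp add: seen_def sum.distrib)
qed

text \<open>Averaged over the \<open>n * fact n\<close> pairs: one query for \<open>s\<close>, at
  most \<open>2 * harm n\<close> for the search and at most \<open>2 * harm n\<close> for the
  walk.\<close>

lemma sum_length_transcript_le:
  "(\<Sum>(s, xs)\<in>{1..n} \<times> permutations_of_set {1..n}. real (length (transcript f n s xs)))
     \<le> real n * fact n * (1 + 4 * harm n)"
proof -
  let ?N = "dom f \<inter> {1..n}" and ?\<Pi> = "permutations_of_set {1..n}"
  let ?p = "pred_in (dom f)"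
  define hit :: "nat \<Rightarrow> nat \<Rightarrow> nat list \<Rightarrow> real"
    where "hit w s xs = of_bool (w \<in> set (search (dom f) xs s))" for w s xs
  have "(\<Sum>(s, xs)\<in>{1..n} \<times> ?\<Pi>. real (length (transcript f n s xs)))
      = (\<Sum>s\<in>{1..n}. \<Sum>xs\<in>?\<Pi>. 1 + (if s \<in> dom f then real (length (seen (dom f) n s xs)) else 0))"
    by (simp add: sum.cartesian_product[symmetric] transcript_def) (intro sum.cong refl; simp)
  also have "\<dots> = (\<Sum>s\<in>{1..n}. fact n +
      (if s \<in> dom f then \<Sum>xs\<in>?\<Pi>. real (length (seen (dom f) n s xs)) else 0))"
    by (intro sum.cong refl) (simp add: sum.distrib)
  also have "\<dots> = real n * fact n
      + (\<Sum>s\<in>{1..n}. if s \<in> dom f then \<Sum>xs\<in>?\<Pi>. real (length (seen (dom f) n s xs)) else 0)"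
    by (simp add: sum.distrib)
  also have "(\<Sum>s\<in>{1..n}. if s \<in> dom f then \<Sum>xs\<in>?\<Pi>. real (length (seen (dom f) n s xs)) else 0)
      = (\<Sum>s\<in>?N. \<Sum>xs\<in>?\<Pi>. real (length (seen (dom f) n s xs)))"
    by (subst Int_commute) (rule sum.inter_restrict[symmetric], simp)
  also have "\<dots> \<le> (\<Sum>s\<in>?N. \<Sum>xs\<in>?\<Pi>. \<Sum>x\<in>{1..n}. hit x s xs + hit (?p x) s xs)"
  proof (intro sum_mono)
    fix s xs assume "xs \<in> ?\<Pi>"
    from length_seen_le[OF this, of "dom f" s]
    have "real (length (seen (dom f) n s xs)) \<le> real (\<Sum>x\<in>{1..n}.
        of_bool (x \<in> set (search (dom f) xs s)) + of_bool (?p x \<in> set (search (dom f) xs s)))"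
      unfolding of_nat_le_iff .
    then show "real (length (seen (dom f) n s xs)) \<le> (\<Sum>x\<in>{1..n}. hit x s xs + hit (?p x) s xs)"
      by (simp add: hit_def)
  qed
  also have "\<dots> = (\<Sum>s\<in>?N. \<Sum>x\<in>{1..n}. \<Sum>xs\<in>?\<Pi>. hit x s xs + hit (?p x) s xs)"
    by (intro sum.cong refl, rule sum.swap)
  also have "\<dots> = (\<Sum>x\<in>{1..n}. \<Sum>s\<in>?N. \<Sum>xs\<in>?\<Pi>. hit x s xs + hit (?p x) s xs)"
    by (rule sum.swap)
  also have "\<dots> = (\<Sum>x\<in>{1..n}. (\<Sum>s\<in>?N. \<Sum>xs\<in>?\<Pi>. hit x s xs) + (\<Sum>s\<in>?N. \<Sum>xs\<in>?\<Pi>. hit (?p x) s xs))"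
    by (simp only: sum.distrib)
  \<comment> \<open>The bound of \<open>search_hits_le\<close> is uniform in the point, so several
    \<open>x\<close> may share a predecessor.\<close>
  also have "\<dots> \<le> (\<Sum>x\<in>{1..n}. 2 * harm n * fact n + 2 * harm n * fact n)"
    unfolding hit_def by (intro sum_mono add_mono search_hits_le pred_in_range)
  finally show ?thesis by (simp add: algebra_simps)
qed

section \<open>Correctness of a round for a fixed permutation\<close>

lemma nonerased_eq: "nonerased n f = dom f \<inter> {1..n}"
  by (auto simp: nonerased_def)

text \<open>Translates the outcome into search paths. Cutting \<open>dom f\<close> down to
  \<open>{1..n}\<close> changes nothing, as the segments and the gaps passed by the walk stay inside
  \<open>{1..n}\<close>.\<close>

lemma verdict_eq:
  assumes "s \<in> nonerased n f" "xs \<in> permutations_of_set {1..n}"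
  shows "verdict f n s xs \<longleftrightarrow>
    convex_fun_on (path_succ xs (nonerased n f) (nonerased n f) s) (\<lambda>x. the (f x))"
proof -
  let ?N = "dom f" and ?M = "nonerased n f"
  let ?P = "dom f \<inter> set (search (dom f) xs s)"
  have xs: "set xs = {1..n}" "distinct xs" using permutations_of_setD[OF assms(2)] by auto
  have s: "s \<in> dom f" "s \<in> {1..n}" using assms(1) by (auto simp: nonerased_eq)
  have P: "?P = search_path xs ?M s"
  proof (rule set_eqI)
    fix x
    have eq: "insert x (?N \<inter> seg x s) = ?M \<inter> seg x s" if "x \<in> ?M"
    proof -
      have "seg x s \<subseteq> {1..n}" using s that by (auto simp: seg_def nonerased_eq)
      then show ?thesis using that seg_ends(1)[of x s] unfolding nonerased_eq by blast
    qed
    have "x \<in> ?P \<longleftrightarrow> x \<in> ?M \<and> first xs (insert x (?N \<inter> seg x s)) = x"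
      unfolding set_search[OF xs(2)] xs(1) by (auto simp: nonerased_eq)
    also have "\<dots> \<longleftrightarrow> x \<in> search_path xs ?M s"
      using eq unfolding search_path_def by auto
    finally show "x \<in> ?P \<longleftrightarrow> x \<in> search_path xs ?M s" .
  qed
  have adj: "adjacent ?N a b \<longleftrightarrow> adjacent ?M a b" if "a \<in> ?M" "b \<in> {1..n}" for a b
    using that by (force simp: adjacent_def nonerased_eq)
  have "?N \<inter> set (walk ?N ?P n) = {b \<in> ?M. \<exists>a\<in>search_path xs ?M s. adjacent ?M a b}"
    unfolding set_walk P using adj by (auto simp: search_path_def nonerased_eq)
  then have "?N \<inter> set (seen ?N n s xs) = path_succ xs ?M ?M s"
    unfolding path_succ_def seen_def set_append Int_Un_distrib P by simp
  then show ?thesis using s unfolding verdict_def by simp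
qed

lemma verdict_convex:
  assumes "restoration n f f'" "convex_fun_on {1..n} f'"
    and "s \<in> {1..n}" "xs \<in> permutations_of_set {1..n}"
  shows "verdict f n s xs"
proof (cases "s \<in> dom f")
  case True
  have "path_succ xs (nonerased n f) (nonerased n f) s \<subseteq> nonerased n f"
    unfolding path_succ_def search_path_def by blast
  moreover have "convex_fun_on (nonerased n f) (\<lambda>x. the (f x))"
  proof -
    have "convex_fun_on (nonerased n f) f'"
      by (rule convex_fun_on_subset[OF assms(2)]) (auto simp: nonerased_def)
    moreover have eq: "f' x = the (f x)" if "x \<in> nonerased n f" for x
      using assms(1) that by (simp add: restoration_def)
    ultimately show ?thesis by (subst (asm) convex_fun_on_cong[OF eq])
  qed
  ultimately have "convex_fun_on (path_succ xs (nonerased n f) (nonerased n f) s) (\<lambda>x. the (f x))"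
    by (rule convex_fun_on_subset[rotated])
  moreover have "s \<in> nonerased n f" using True assms(3) by (simp add: nonerased_eq)
  ultimately show ?thesis using verdict_eq[OF _ assms(4)] by blast
qed (simp add: verdict_def)

lemma card_reject_ge:
  assumes far: "erased_far n \<epsilon> (convex_fun_on {1..n}) f" and xs: "xs \<in> permutations_of_set {1..n}"
  shows "\<epsilon> * real (card (nonerased n f)) \<le> real (card {s \<in> {1..n}. \<not> verdict f n s xs})"
proof -
  let ?M = "nonerased n f"
  define G where "G = {s \<in> ?M. verdict f n s xs}"
  have fin: "finite ?M" by (simp add: nonerased_eq)
  have G: "G \<subseteq> ?M" by (auto simp: G_def)
  have M: "?M \<subseteq> set xs" using permutations_of_setD(1)[OF xs] by (simp add: nonerased_eq)
  have path: "convex_fun_on (path_succ xs ?M ?M s \<union> {}) (\<lambda>x. the (f x))" if "s \<in> G" for s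
    using that verdict_eq[OF _ xs] unfolding G_def Un_empty_right by blast
  have "convex_fun_on G (\<lambda>x. the (f x))"
  proof (cases "G = {}")
    case True
    then show ?thesis by (simp add: convex_fun_on_def)
  next
    case False
    have "convex_fun_on (G \<union> {}) (\<lambda>x. the (f x))"
      by (rule convex_fun_on_good_points[OF fin order_refl M G False empty_subsetI fin path])
    then show ?thesis by simp
  qed
  moreover have "finite G" by (rule finite_subset[OF G fin])
  ultimately obtain g where g: "convex_fun_on UNIV g" "\<And>x. x \<in> G \<Longrightarrow> g x = the (f x)"
    using convex_extension[of G "\<lambda>x. the (f x)"] by blast
  \<comment> \<open>At erased points the unspecified \<open>the None\<close> serves as value; the
    distance counts nonerased points only.\<close>
  have "restoration n f (\<lambda>x. the (f x))"
    by (auto simp: restoration_def nonerased_def)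
  moreover have "convex_fun_on {1..n} g"
    using g(1) by (rule convex_fun_on_subset) simp
  ultimately have "\<epsilon> * real (card ?M) \<le> real (card {x \<in> ?M. g x \<noteq> the (f x)})"
    using far unfolding erased_far_def by simp
  \<comment> \<open>\<open>g\<close> agrees with \<open>f\<close> on \<open>G\<close>, so every
    changed point is a rejected one.\<close>
  also have "card {x \<in> ?M. g x \<noteq> the (f x)} \<le> card {s \<in> {1..n}. \<not> verdict f n s xs}"
    using g(2) by (intro card_mono) (auto simp: G_def nonerased_def)
  finally show ?thesis by simp
qed

section \<open>The random round\<close>

definition convexity_round :: "nat \<Rightarrow> query_alg" where
  "convexity_round n = Toss (map_pmf (\<lambda>(s, xs). test n s xs)
     (pmf_of_set ({1..n} \<times> permutations_of_set {1..n})))"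

context
  fixes n :: nat
  assumes n: "n \<ge> 1"
begin

abbreviation (input) "\<Omega> \<equiv> {1..n} \<times> permutations_of_set {1..n}"

lemma \<Omega>_facts: "finite \<Omega>" "\<Omega> \<noteq> {}" "card \<Omega> = n * fact n"
  using n by (auto simp: card_cartesian_product)

lemma run_convexity_round:
  "run f (convexity_round n) =
     map_pmf (\<lambda>(s, xs). (verdict f n s xs, transcript f n s xs)) (pmf_of_set \<Omega>)"
  unfolding convexity_round_def run_Toss bind_map_pmf
  unfolding map_pmf_def
  by (intro bind_pmf_cong refl) (simp add: case_prod_unfold run_test)

lemma set_pmf_convexity_round:
  "set_pmf (run f (convexity_round n)) = (\<lambda>(s, xs). (verdict f n s xs, transcript f n s xs)) ` \<Omega>"
  unfolding run_convexity_round set_map_pmf set_pmf_of_set[OF \<Omega>_facts(2,1)] ..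

lemma queries_convexity_round:
  assumes "(b, ys) \<in> set_pmf (run f (convexity_round n))"
  shows "set ys \<subseteq> {1..n}"
proof -
  obtain s xs where "(s, xs) \<in> \<Omega>" "ys = transcript f n s xs"
    using assms unfolding set_pmf_convexity_round by (force simp del: atLeastAtMost_iff)
  moreover have "set (search (dom f) xs s) \<subseteq> set xs"
    unfolding search_def by (rule set_queried_subset)
  moreover have "set (walk (dom f) V n) \<subseteq> {1..n}" for V
    unfolding set_walk by blast
  ultimately show ?thesis
    using permutations_of_setD(1)[of xs "{1..n}"] unfolding transcript_def seen_def
    by (simp split: if_splits) blast
qed

lemma accept_prob_convexity_round:
  assumes "restoration n f f'" "convex_fun_on {1..n} f'"
  shows "accept_prob f (convexity_round n) = 1"
proof -
  have "fst r" if r: "r \<in> set_pmf (run f (convexity_round n))" for r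
  proof -
    obtain w where w: "r = (\<lambda>(s, xs). (verdict f n s xs, transcript f n s xs)) w" "w \<in> \<Omega>"
      using r[unfolded set_pmf_convexity_round] by (rule imageE)
    show ?thesis
      using w verdict_convex[OF assms, of "fst w" "snd w"] by (simp add: case_prod_unfold mem_Times_iff)
  qed
  then have "AE r in run f (convexity_round n). r \<in> {(b, xs). b}"
    unfolding AE_measure_pmf_iff by (simp add: case_prod_unfold)
  then show ?thesis
    unfolding accept_prob_def by (subst measure_pmf.prob_eq_1) simp_all
qed

text \<open>\<open>card_reject_ge\<close> holds for every single permutation, and at least
  \<open>(1 - \<alpha>) * n\<close> points are nonerased; summing over permutations gives at least
  \<open>\<epsilon> * (1 - \<alpha>) * n * fact n\<close> rejecting pairs.\<close>

lemma reject_prob_convexity_round: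
  assumes "erased_fun n \<alpha> f" "erased_far n \<epsilon> (convex_fun_on {1..n}) f" "0 \<le> \<epsilon>"
  shows "reject_prob f (convexity_round n) \<ge> \<epsilon> * (1 - \<alpha>)"
proof -
  let ?\<Pi> = "permutations_of_set {1..n}"
  have "card (nonerased n f) = n - card {x \<in> {1..n}. f x = None}"
  proof -
    have "nonerased n f = {1..n} - {x \<in> {1..n}. f x = None}" by (auto simp: nonerased_def)
    moreover have "card ({1..n} - {x \<in> {1..n}. f x = None})
        = card {1..n} - card {x \<in> {1..n}. f x = None}"
      by (rule card_Diff_subset) auto
    ultimately show ?thesis by (simp only: card_atLeastAtMost diff_Suc_1)
  qed
  moreover have "card {x \<in> {1..n}. f x = None} \<le> card {1..n}" by (rule card_mono) auto
  ultimately have M: "(1 - \<alpha>) * real n \<le> real (card (nonerased n f))"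
    using assms(1) by (simp add: erased_fun_def of_nat_diff algebra_simps)
  have "real n * fact n * (\<epsilon> * (1 - \<alpha>)) = (\<Sum>xs\<in>?\<Pi>. \<epsilon> * ((1 - \<alpha>) * real n))"
    by simp
  also have "\<dots> \<le> (\<Sum>xs\<in>?\<Pi>. \<epsilon> * real (card (nonerased n f)))"
    using M assms(3) by (intro sum_mono mult_left_mono)
  also have "\<dots> \<le> (\<Sum>xs\<in>?\<Pi>. real (card {s \<in> {1..n}. \<not> verdict f n s xs}))"
    using card_reject_ge[OF assms(2)] by (intro sum_mono)
  also have "\<dots> = (\<Sum>xs\<in>?\<Pi>. \<Sum>s\<in>{1..n}. of_bool (\<not> verdict f n s xs))"
    by (simp add: sum_of_bool_eq Int_def)
  also have "\<dots> = (\<Sum>(s, xs)\<in>\<Omega>. of_bool (\<not> verdict f n s xs))"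
    by (subst sum.swap) (rule sum.cartesian_product)
  also have "\<dots> = real (card (\<Omega> \<inter> {(s, xs). \<not> verdict f n s xs}))"
    using \<Omega>_facts(1) by (simp add: case_prod_unfold sum_of_bool_eq)
  finally have "real n * fact n * (\<epsilon> * (1 - \<alpha>)) \<le> real (card (\<Omega> \<inter> {(s, xs). \<not> verdict f n s xs}))" .
  moreover have "reject_prob f (convexity_round n)
      = real (card (\<Omega> \<inter> {(s, xs). \<not> verdict f n s xs})) / real (n * fact n)"
  proof -
    have "(\<lambda>(s, xs). (verdict f n s xs, transcript f n s xs)) -` {(b, xs). \<not> b}
        = {(s, xs). \<not> verdict f n s xs}"
      by (rule set_eqI) (simp add: case_prod_unfold)
    then show ?thesis
      unfolding reject_prob_def run_convexity_round measure_map_pmf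
      by (simp only: measure_pmf_of_set[OF \<Omega>_facts(2,1)] \<Omega>_facts(3))
  qed
  moreover have pos: "0 < real (n * fact n)" using n by simp
  ultimately show ?thesis
    by (simp only: pos_le_divide_eq[OF pos]) (simp add: mult_ac)
qed

lemma expected_queries_convexity_round:
  "expected_queries f (convexity_round n) \<le> ennreal (1 + 4 * harm n)"
proof -
  have "expected_queries f (convexity_round n)
      = (\<Sum>(s, xs)\<in>\<Omega>. of_nat (length (transcript f n s xs))) / of_nat (n * fact n)"
    unfolding expected_queries_def run_convexity_round nn_integral_map_pmf
    by (subst nn_integral_pmf_of_set[OF \<Omega>_facts(2,1)]) (simp add: \<Omega>_facts(3) case_prod_unfold)
  also have "\<dots> = ennreal ((\<Sum>(s, xs)\<in>\<Omega>. real (length (transcript f n s xs))) / real (n * fact n))"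
    using n by (simp add: case_prod_unfold ennreal_of_nat_eq_real_of_nat divide_ennreal sum_nonneg)
  also have "\<dots> \<le> ennreal (1 + 4 * harm n)"
    using sum_length_transcript_le[of f n] n by (intro ennreal_leI) (simp add: field_simps)
  finally show ?thesis .
qed

end

section \<open>The tester\<close>

lemma harm_le_ln: "harm (Suc n) \<le> 1 + ln (real (Suc n))"
proof (induction n)
  case 0
  show ?case by (simp add: harm_def)
next
  case (Suc n)
  \<comment> \<open>\<open>ln x \<le> x - 1\<close> at \<open>x = k / (k + 1)\<close> bounds the new
    term \<open>1 / (k + 1)\<close> by the growth of the logarithm, with
    \<open>k = Suc n\<close>.\<close>
  have "ln (real (Suc n) / real (Suc (Suc n))) \<le> real (Suc n) / real (Suc (Suc n)) - 1"
    by (rule ln_le_minus_one) simp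
  also have "\<dots> = - inverse (real (Suc (Suc n)))"
    by (simp add: field_simps)
  finally have "inverse (real (Suc (Suc n))) \<le> ln (real (Suc (Suc n))) - ln (real (Suc n))"
    by (simp add: ln_div del: of_nat_Suc)
  then show ?case using Suc by (simp add: harm_Suc[of "Suc n"] del: of_nat_Suc)
qed

text \<open>For \<open>n \<ge> 2\<close> the logarithm to base 2 is at least 1 and absorbs the
  additive constant.\<close>

lemma harm_le_log:
  assumes "n \<ge> 2"
  shows "harm n \<le> 2 * log 2 (real n)"
proof -
  have "ln (real n) \<le> log 2 (real n)"
  proof -
    have "ln (real n) * ln 2 \<le> ln (real n) * 1"
      using assms ln_2_less_1 by (intro mult_left_mono) auto
    then show ?thesis by (simp add: log_def field_simps)
  qed
  moreover have "1 \<le> log 2 (real n)" using assms by simp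
  moreover have "harm n \<le> 1 + ln (real n)" using harm_le_ln[of "n - 1"] assms by simp
  ultimately show ?thesis by linarith
qed

lemma exp_minus_2_le: "exp (- 2) \<le> (1 / 6 :: real)"
proof -
  \<comment> \<open>The quadratic Taylor bound \<open>1 + 1 + 1 / 2\<close> suffices, as its square
    \<open>25 / 4\<close> exceeds 6.\<close>
  have "5 / 2 \<le> exp (1 :: real)" using exp_lower_Taylor_quadratic[of 1] by simp
  then have "(5 / 2) * (5 / 2) \<le> exp 1 * exp (1 :: real)" by (intro mult_mono) auto
  also have "\<dots> = exp 2" by (simp flip: exp_add)
  finally show ?thesis by (simp add: exp_minus field_simps)
qed

text \<open>For \<open>n = 1\<close> a budget proportional to \<open>log 2 1 = 0\<close> permits no
  query, so no input may be far. Indeed \<open>\<alpha> < 1\<close> makes the only point nonerased,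
  and every function on it is convex.\<close>

lemma not_erased_far_1:
  assumes "\<alpha> < 1" "0 < \<epsilon>" "erased_fun 1 \<alpha> f"
  shows "\<not> erased_far 1 \<epsilon> (convex_fun_on {1..1}) f"
proof
  assume far: "erased_far 1 \<epsilon> (convex_fun_on {1..1}) f"
  have "{x \<in> {1..1}. f x = None} = {}"
  proof (rule ccontr)
    assume "{x \<in> {1..1}. f x = None} \<noteq> {}"
    then have "{x \<in> {1..1}. f x = None} = {1}" by auto
    then show False using assms by (simp add: erased_fun_def)
  qed
  then have N: "nonerased 1 f = {1}" by (auto simp: nonerased_def)
  have "restoration 1 f (\<lambda>x. the (f x))" by (auto simp: restoration_def nonerased_def)
  moreover have "convex_fun_on {1..1} (\<lambda>x. the (f x))" by (simp add: convex_fun_on_def)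
  ultimately have "\<epsilon> * real (card (nonerased 1 f)) \<le>
      real (card {x \<in> nonerased 1 f. the (f x) \<noteq> the (f x)})"
    using far unfolding erased_far_def by blast
  then show False using assms(2) N by simp
qed

text \<open>
  By Markov's inequality the budget is exceeded with probability at most \<open>1 / 6\<close>: the expected
  number of queries is at most \<open>27 = 162 / 6\<close> times \<open>log 2 n / (\<epsilon> (1 - \<alpha>))\<close> for \<open>n \<ge> 2\<close>. For
  \<open>n = 1\<close> the budget is \<open>0\<close>, and the tester accepts without a query.
\<close>

definition convexity_tester :: "nat \<Rightarrow> real \<Rightarrow> real \<Rightarrow> query_alg" where
  "convexity_tester n \<alpha> \<epsilon> =
     truncate_alg (repeat_alg (nat \<lceil>2 / (\<epsilon> * (1 - \<alpha>))\<rceil>) (convexity_round n))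
       (nat \<lfloor>162 * (log 2 (real n) / (\<epsilon> * (1 - \<alpha>)))\<rfloor>)"

lemma accept_prob_convexity_tester:
  assumes "n \<ge> 1" "restoration n f f'" "convex_fun_on {1..n} f'"
  shows "accept_prob f (convexity_tester n \<alpha> \<epsilon>) = 1"
proof -
  have "reject_prob f (convexity_tester n \<alpha> \<epsilon>) \<le> 0"
    using reject_prob_truncate_alg_le accept_prob_convexity_round[OF assms]
    unfolding convexity_tester_def
    by (metis accept_prob_repeat_alg diff_self power_one reject_prob_eq)
  moreover have "0 \<le> reject_prob f (convexity_tester n \<alpha> \<epsilon>)"
    unfolding reject_prob_def by (rule measure_nonneg)
  ultimately show ?thesis unfolding reject_prob_eq by linarith
qed

text \<open>Two failures of probability at most \<open>1 / 6\<close> each: all \<open>t\<close>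
  rounds accept, which has probability at most \<open>(1 - \<delta>) ^ t \<le> exp (- 2)\<close>, or
  the budget is exceeded.\<close>

lemma reject_prob_convexity_tester:
  assumes n: "n \<ge> 2" and \<alpha>: "0 < \<alpha>" "\<alpha> < 1" and \<epsilon>: "0 < \<epsilon>" "\<epsilon> < 1"
    and f: "erased_fun n \<alpha> f" "erased_far n \<epsilon> (convex_fun_on {1..n}) f"
  shows "reject_prob f (convexity_tester n \<alpha> \<epsilon>) \<ge> 2 / 3"
proof -
  define \<delta> where "\<delta> = \<epsilon> * (1 - \<alpha>)"
  define t where "t = nat \<lceil>2 / \<delta>\<rceil>"
  define L where "L = log 2 (real n)"
  define q where "q = nat \<lfloor>162 * (L / \<delta>)\<rfloor>"
  define A where "A = repeat_alg t (convexity_round n)"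
  define e where "e = real t * (1 + 4 * harm n)"
  have \<delta>: "0 < \<delta>" using \<alpha> \<epsilon> by (simp add: \<delta>_def)
  have "\<delta> \<le> 1 * 1" unfolding \<delta>_def using \<alpha> \<epsilon> by (intro mult_mono) auto
  then have "1 \<le> 1 / \<delta>" using \<delta> by simp
  have L: "1 \<le> L" using n by (simp add: L_def)
  have t_ge: "2 / \<delta> \<le> real t" unfolding t_def by (rule real_nat_ceiling_ge)
  \<comment> \<open>Rounding up costs at most 1, and \<open>1 \<le> 1 / \<delta>\<close> turns this
    into \<open>3 / \<delta>\<close>. Positivity of \<open>2 / \<delta>\<close> keeps
    \<open>nat\<close> from clipping.\<close>
  have "real t \<le> 2 / \<delta> + 1"
    using divide_pos_pos[OF zero_less_numeral \<delta>, of "num.Bit0 num.One"] unfolding t_def by linarith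
  then have t_le: "real t \<le> 3 / \<delta>" using \<open>1 \<le> 1 / \<delta>\<close> by (simp add: field_simps)
  have acc: "accept_prob f (convexity_round n) \<le> 1 - \<delta>"
    using reject_prob_convexity_round[of n \<alpha> f \<epsilon>] f n \<epsilon> unfolding reject_prob_eq \<delta>_def by simp
  have acc0: "0 \<le> accept_prob f (convexity_round n)"
    unfolding accept_prob_def by (rule measure_nonneg)
  have "accept_prob f A \<le> 1 / 6"
  proof -
    have "accept_prob f A \<le> (1 - \<delta>) ^ t"
      unfolding A_def accept_prob_repeat_alg using acc acc0 by (rule power_mono)
    also have "\<dots> \<le> exp (- \<delta>) ^ t"
      using acc acc0 exp_ge_add_one_self[of "- \<delta>"] by (intro power_mono) auto
    also have "\<dots> = exp (- (real t * \<delta>))" by (simp flip: exp_of_nat_mult)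
    also have "\<dots> \<le> exp (- 2)" using t_ge \<delta> by (simp add: field_simps)
    also note exp_minus_2_le
    finally show ?thesis .
  qed
  moreover have "e / (real q + 1) \<le> 1 / 6"
  proof -
    \<comment> \<open>From \<open>harm n \<le> 2 * L\<close> and \<open>1 \<le> L\<close>. With at
      most \<open>3 / \<delta>\<close> rounds this gives the factor 27, and
      \<open>162 = 6 * 27\<close>.\<close>
    have "1 + 4 * harm n \<le> 9 * L" using harm_le_log[OF n] L unfolding L_def by linarith
    then have "e \<le> 3 / \<delta> * (9 * L)"
      unfolding e_def using t_le \<delta> by (intro mult_mono) (auto simp: harm_nonneg)
    \<comment> \<open>Rounding the budget down loses less than one query, which the
      \<open>+ 1\<close> in Markov's bound makes up.\<close>
    moreover have "162 * (L / \<delta>) \<le> real q + 1" unfolding q_def by linarith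
    moreover have "3 / \<delta> * (9 * L) = 27 * (L / \<delta>)" by simp
    ultimately have "6 * e \<le> real q + 1" by linarith
    then show ?thesis by (simp add: field_simps)
  qed
  moreover have "expected_queries f A \<le> ennreal e"
  proof -
    have "expected_queries f A \<le> of_nat t * ennreal (1 + 4 * harm n)"
      unfolding A_def using n
      by (intro order_trans[OF expected_queries_repeat_alg] mult_left_mono
          expected_queries_convexity_round) auto
    also have "\<dots> = ennreal e"
      unfolding e_def by (simp add: ennreal_of_nat_eq_real_of_nat ennreal_mult harm_nonneg)
    finally show ?thesis .
  qed
  then have "reject_prob f A - e / (real q + 1) \<le> reject_prob f (truncate_alg A q)"
    by (rule reject_prob_truncate_alg_ge) (simp add: e_def harm_nonneg)
  ultimately have "2 / 3 \<le> reject_prob f (truncate_alg A q)"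
    unfolding reject_prob_eq[of f A] by linarith
  then show ?thesis
    unfolding convexity_tester_def A_def q_def t_def L_def \<delta>_def .
qed

theorem theorem1p6:
  "\<exists>T :: nat \<Rightarrow> real \<Rightarrow> real \<Rightarrow> query_alg.
     (\<forall>n \<alpha> \<epsilon>. n \<ge> 1 \<and> 0 < \<alpha> \<and> \<alpha> < 1 \<and> 0 < \<epsilon> \<and> \<epsilon> < 1 \<longrightarrow>
        erasure_resilient_tester n \<alpha> \<epsilon> (convex_fun_on {1..n}) (T n \<alpha> \<epsilon>) \<and>
        one_sided_error n \<alpha> (convex_fun_on {1..n}) (T n \<alpha> \<epsilon>)) \<and>
     (\<exists>C > 0. \<forall>n \<alpha> \<epsilon>. n \<ge> 1 \<and> 0 < \<alpha> \<and> \<alpha> < 1 \<and> 0 < \<epsilon> \<and> \<epsilon> < 1 \<longrightarrow>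
        ereal_of_enat (query_complexity n \<alpha> (T n \<alpha> \<epsilon>)) \<le>
          ereal (C * (log 2 (real n) / (\<epsilon> * (1 - \<alpha>)))))"
proof (intro exI[of _ convexity_tester] conjI exI[of _ "162 :: real"] allI impI; (elim conjE)?)
  fix n :: nat and \<alpha> \<epsilon> :: real
  assume n: "1 \<le> n" and \<alpha>: "0 < \<alpha>" "\<alpha> < 1" and \<epsilon>: "0 < \<epsilon>" "\<epsilon> < 1"
  let ?T = "convexity_tester n \<alpha> \<epsilon>"
  have accept: "accept_prob f ?T = 1" if "\<exists>f'. restoration n f f' \<and> convex_fun_on {1..n} f'" for f
    using that accept_prob_convexity_tester[OF n] by blast
  have reject: "2 / 3 \<le> reject_prob f ?T"
    if "erased_fun n \<alpha> f" "erased_far n \<epsilon> (convex_fun_on {1..n}) f" for f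
  proof -
    have "n \<noteq> 1" using not_erased_far_1[of \<alpha> \<epsilon> f] that \<alpha> \<epsilon> by blast
    then show ?thesis using n \<alpha> \<epsilon> that by (intro reject_prob_convexity_tester) auto
  qed
  have queries: "set xs \<subseteq> {1..n}" if xs: "(b, xs) \<in> set_pmf (run f ?T)" for f b xs
  proof -
    obtain c ys where ys: "set xs \<subseteq> set ys"
      "(c, ys) \<in> set_pmf (run f (repeat_alg (nat \<lceil>2 / (\<epsilon> * (1 - \<alpha>))\<rceil>) (convexity_round n)))"
      using set_pmf_truncate_alg(2)[OF xs[unfolded convexity_tester_def]] by blast
    have "set ys \<subseteq> {1..n}"
      by (rule queries_repeat_alg[OF _ ys(2)]) (rule queries_convexity_round[OF n])
    with ys(1) show ?thesis by blast
  qed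
  show "erasure_resilient_tester n \<alpha> \<epsilon> (convex_fun_on {1..n}) ?T"
    unfolding erasure_resilient_tester_def using accept reject queries by fastforce
  show "one_sided_error n \<alpha> (convex_fun_on {1..n}) ?T"
    unfolding one_sided_error_def using accept by blast
next
  fix n :: nat and \<alpha> \<epsilon> :: real
  assume n: "1 \<le> n" and \<alpha>: "0 < \<alpha>" "\<alpha> < 1" and \<epsilon>: "0 < \<epsilon>" "\<epsilon> < 1"
  define q where "q = nat \<lfloor>162 * (log 2 (real n) / (\<epsilon> * (1 - \<alpha>)))\<rfloor>"
  have "length xs \<le> q" if "(b, xs) \<in> set_pmf (run f (convexity_tester n \<alpha> \<epsilon>))" for f b xs
    using set_pmf_truncate_alg(1) that unfolding convexity_tester_def q_def by blast
  then have "query_complexity n \<alpha> (convexity_tester n \<alpha> \<epsilon>) \<le> enat q"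
    unfolding query_complexity_def by (auto intro!: SUP_least)
  then have "ereal_of_enat (query_complexity n \<alpha> (convexity_tester n \<alpha> \<epsilon>)) \<le> ereal_of_enat (enat q)"
    by (subst ereal_of_enat_le_iff)
  also have "\<dots> = ereal (real q)" by simp
  \<comment> \<open>The right-hand side is nonnegative because \<open>n \<ge> 1\<close>, so
    \<open>nat\<close> does not raise the value.\<close>
  also have "real q \<le> 162 * (log 2 (real n) / (\<epsilon> * (1 - \<alpha>)))"
    unfolding q_def using n \<alpha> \<epsilon> by simp
  finally show "ereal_of_enat (query_complexity n \<alpha> (convexity_tester n \<alpha> \<epsilon>)) \<le>
      ereal (162 * (log 2 (real n) / (\<epsilon> * (1 - \<alpha>))))"
    by simp
qed simp

end
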